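(* Let $n\ge 2$ and let $\tau$ be a permutation of $\{1,\dots,n-1\}$ with $\tau\neq 12\cdots(n-1)$. Run the greedy algorithm described in the context starting from $\Pi'_{n,0}=\tau$ instead of $12\cdots(n-1)$, let $W$ be its output, and let $C$ be the word obtained from $W$ by deleting its last $n-1$ letters and taking the reduced form. Then $C$, regarded as a cyclic word, is not a universal cycle for $n$-permutations (i.e. it is not the case that every permutation of $\{1,\dots,n\}$ is the reduced form of exactly one cyclic factor of length $n$ of $C$).
   Context: For a word $w$ of distinct integers, $\mathrm{red}(w)$ denotes the word obtained by replacing the $i$-th smallest entry of $w$ by $i$. A factor of a word is a block of consecutive letters; in a cyclic word $c_1\cdots c_N$, the cyclic factors of length $n$ are $c_j\cdots c_{j+n-1}$ for $1\le j\le N$, indices modulo $N$. Extensions: for a word $\pi=\pi_1\cdots\pi_m$ of distinct integers and $1\le i\le m$, the $i$-th extension of $\pi$ is $c_b(\pi_1)\cdots c_b(\pi_m)\,b$, where $b$ is the $i$-th smallest element of $\{\pi_1,\dots,\pi_m\}$ and $c_b(x)=x$ if $x<b$, $c_b(x)=x+1$ if $x\ge b$. The $(m+1)$-st extension of $\pi$ is $\pi b$ with $b=\max_j\pi_j+1$. Greedy algorithm from a start word $\Pi'_{n,0}$ (a permutation of $\{1,\dots,n-1\}$): given $\Pi'_{n,k}=a_1a_2\cdots a_{k+n-1}$ (a permutation of $\{1,\dots,k+n-1\}$ in which no two factors of length $n$ have the same reduced form), let $i\in\{1,\dots,n\}$ be minimal such that the $i$-th extension of $a_{k+1}\cdots a_{k+n-1}$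 has reduced form different from the reduced form of every length-$n$ factor of $\Pi'_{n,k}$, let $b$ be the last element of this extension, and set $\Pi'_{n,k+1}=c_b(a_1)\cdots c_b(a_{k+n-1})\,b$. If no such $i$ exists, the algorithm terminates and outputs $\Pi'_{n,k}$. *)

theory Defs
  imports
    "HOL-Library.Sublist"
    "HOL-Combinatorics.Multiset_Permutations"
begin

text \<open>
  Words are lists. Every word on which the algorithm operates has positive integer entries, so
  type \<^typ>\<open>nat\<close> is used. Positions of letters are counted from 0; the extension
  index \<open>i\<close> is counted from 1.
\<close>

definition red :: "'a::linorder list \<Rightarrow> nat list" where
  "red w = map (\<lambda>x. card {y \<in> set w. y \<le> x}) w"

definition factors :: "nat \<Rightarrow> 'a list \<Rightarrow> 'a list set" where
  "factors n w = {u. sublist u w \<and> length u = n}"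

definition cyclic_factor :: "'a list \<Rightarrow> nat \<Rightarrow> nat \<Rightarrow> 'a list" where
  "cyclic_factor c n j = map (\<lambda>k. c ! ((j + k) mod length c)) [0..<n]"

text \<open>
  Cyclic factors are counted by their starting position. If \<open>c\<close> is shorter than
  \<open>n\<close>, its cyclic factors of length \<open>n\<close> repeat letters, hence so do their
  images under \<^const>\<open>red\<close>, and none of them is a permutation.
\<close>

definition universal_cycle :: "nat \<Rightarrow> 'a::linorder list \<Rightarrow> bool" where
  "universal_cycle n c \<longleftrightarrow>
     (\<forall>p \<in> permutations_of_set {1..n}. \<exists>!j. j < length c \<and> red (cyclic_factor c n j) = p)"

definition bump :: "nat \<Rightarrow> nat \<Rightarrow> nat" where
  "bump b x = (if x < b then x else x + 1)"

text \<open>Meaningful for \<open>1 \<le> i \<le> length \<pi> + 1\<close>.\<close>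

definition extension :: "nat \<Rightarrow> nat list \<Rightarrow> nat list" where
  "extension i \<pi> =
     (if i \<le> length \<pi>
      then let b = sorted_list_of_set (set \<pi>) ! (i - 1) in map (bump b) \<pi> @ [b]
      else \<pi> @ [Max (set \<pi>) + 1])"

definition last_letters :: "nat \<Rightarrow> 'a list \<Rightarrow> 'a list" where
  "last_letters m w = drop (length w - m) w"

definition admissible :: "nat \<Rightarrow> nat list \<Rightarrow> nat \<Rightarrow> bool" where
  "admissible n w i \<longleftrightarrow>
     i \<in> {1..n} \<and> red (extension i (last_letters (n - 1) w)) \<notin> red ` factors n w"

definition greedy_step :: "nat \<Rightarrow> nat list \<Rightarrow> nat list option" where
  "greedy_step n w =
     (if \<exists>i. admissible n w i
      then let i = (LEAST i. admissible n w i);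
               b = last (extension i (last_letters (n - 1) w))
           in Some (map (bump b) w @ [b])
      else None)"

text \<open>
  The value \<open>Some w\<close> at \<open>k\<close> means that the algorithm performs at least
  \<open>k\<close> steps and that \<open>w\<close> is the word after step \<open>k\<close>;
  \<open>None\<close> means that it terminates earlier.
\<close>

primrec greedy_word :: "nat \<Rightarrow> nat list \<Rightarrow> nat \<Rightarrow> nat list option" where
  "greedy_word n \<tau> 0 = Some \<tau>"
| "greedy_word n \<tau> (Suc k) = Option.bind (greedy_word n \<tau> k) (greedy_step n)"

definition greedy_output :: "nat \<Rightarrow> nat list \<Rightarrow> nat list \<Rightarrow> bool" where
  "greedy_output n \<tau> W \<longleftrightarrow>
     (\<exists>k. greedy_word n \<tau> k = Some W \<and> greedy_step n W = None)"

text \<open>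
  The remaining facts show that \<^const>\<open>greedy_output\<close> determines exactly one word,
  because every step adds a new reduced form to the finite set of those already present.
\<close>

lemma strict_mono_bump: "strict_mono (bump b)"
  by (auto simp: strict_mono_def bump_def)

lemma red_map_bump: "red (map (bump b) w) = red w"
proof -
  have "card {y \<in> bump b ` set w. y \<le> bump b x} = card {y \<in> set w. y \<le> x}" for x
  proof -
    have "{y \<in> bump b ` set w. y \<le> bump b x} = bump b ` {y \<in> set w. y \<le> x}"
      using strict_mono_less_eq[OF strict_mono_bump] by auto
    moreover have "inj_on (bump b) A" for A
      using strict_mono_bump strict_mono_imp_inj_on inj_on_subset by blast
    ultimately show ?thesis by (simp add: card_image)
  qed
  then show ?thesis by (simp add: red_def)
qed

lemma finite_red_factors: "finite (red ` factors n w)"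
  and card_red_factors_le: "card (red ` factors n w) \<le> card {xs. set xs \<subseteq> {..n} \<and> length xs = n}"
proof -
  have "red u \<in> {xs. set xs \<subseteq> {..n} \<and> length xs = n}" if "length u = n" for u :: "'a list"
  proof -
    have "card {y \<in> set u. y \<le> x} \<le> n" for x
      using card_mono[of "set u" "{y \<in> set u. y \<le> x}"] card_length[of u] that by auto
    then show ?thesis using that by (auto simp: red_def)
  qed
  then have "red ` factors n w \<subseteq> {xs. set xs \<subseteq> {..n} \<and> length xs = n}"
    unfolding factors_def by blast
  moreover have "finite {xs. set xs \<subseteq> {..n} \<and> length xs = n}"
    by (rule finite_lists_length_eq) simp
  ultimately show "finite (red ` factors n w)"
    and "card (red ` factors n w) \<le> card {xs. set xs \<subseteq> {..n} \<and> length xs = n}"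
    by (auto intro: finite_subset card_mono)
qed

lemma extension_eq: "extension i v = map (bump (last (extension i v))) v @ [last (extension i v)]"
proof (cases "i \<le> length v")
  case True
  then show ?thesis by (simp add: extension_def Let_def)
next
  case False
  have "x < Suc (Max (set v))" if "x \<in> set v" for x
    using that by (simp add: less_Suc_eq_le)
  then show ?thesis using False by (auto simp: extension_def bump_def intro!: map_idI[symmetric])
qed

lemma greedy_step_card:
  assumes "greedy_step n w = Some w'" and "n \<le> length w + 1"
  shows "card (red ` factors n w) < card (red ` factors n w')" and "n \<le> length w' + 1"
proof -
  define v where "v = last_letters (n - 1) w"
  define i where "i = (LEAST i. admissible n w i)"
  define b where "b = last (extension i v)"
  have ex: "\<exists>i. admissible n w i" and w': "w' = map (bump b) w @ [b]"
    using assms(1) by (auto simp: greedy_step_def Let_def v_def i_def b_def split: if_splits)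
  have adm: "admissible n w i" unfolding i_def using ex by (metis LeastI)
  have e: "extension i v = map (bump b) v @ [b]"
    unfolding b_def by (rule extension_eq)
  have w: "w = take (length w - (n - 1)) w @ v"
    by (simp add: v_def last_letters_def)
  have "length v = n - 1" using assms(2) by (simp add: v_def last_letters_def)
  moreover have "n \<ge> 1" using adm by (simp add: admissible_def)
  moreover have "w' = map (bump b) (take (length w - (n - 1)) w) @ extension i v"
    unfolding w' e using w by (metis append.assoc map_append)
  then have "sublist (extension i v) w'" by auto
  ultimately have "extension i v \<in> factors n w'"
    by (simp add: factors_def e)
  moreover have "red u \<in> red ` factors n w'" if "u \<in> factors n w" for u
  proof -
    have "sublist (map (bump b) u) w'"
      using that map_mono_sublist[of u w "bump b"] unfolding w' factors_def
      by (auto intro: sublist_order.order_trans)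
    then have "map (bump b) u \<in> factors n w'" using that by (simp add: factors_def)
    then show ?thesis by (metis red_map_bump imageI)
  qed
  moreover have "red (extension i v) \<notin> red ` factors n w"
    using adm by (simp add: admissible_def v_def)
  ultimately have "red ` factors n w \<subset> red ` factors n w'" by blast
  then show "card (red ` factors n w) < card (red ` factors n w')"
    by (intro psubset_card_mono finite_red_factors)
  show "n \<le> length w' + 1" using assms(2) w' by simp
qed

lemma greedy_word_card:
  assumes "greedy_word n \<tau> k = Some w" and "n \<le> length \<tau> + 1"
  shows "k \<le> card (red ` factors n w) \<and> n \<le> length w + 1"
  using assms(1)
proof (induction k arbitrary: w)
  case 0
  then show ?case using assms(2) by simp
next
  case (Suc k)
  then obtain u where "greedy_word n \<tau> k = Some u" "greedy_step n u = Some w"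
    by (auto simp: bind_eq_Some_conv)
  with Suc.IH[of u] greedy_step_card[of n u w] show ?case by force
qed

lemma greedy_word_mono: "greedy_word n \<tau> k = None \<Longrightarrow> k \<le> l \<Longrightarrow> greedy_word n \<tau> l = None"
  by (induction l) (auto simp: le_Suc_eq)

lemma ex1_greedy_output:
  assumes "n \<le> length \<tau> + 1"
  shows "\<exists>!W. greedy_output n \<tau> W"
proof -
  let ?K = "Suc (card {xs::nat list. set xs \<subseteq> {..n} \<and> length xs = n})"
  have "greedy_word n \<tau> ?K = None"
  proof (rule ccontr)
    assume "greedy_word n \<tau> ?K \<noteq> None"
    then obtain w where "greedy_word n \<tau> ?K = Some w" by blast
    then show False using greedy_word_card[of n \<tau> ?K w] assms card_red_factors_le[of n w] by simp
  qed
  then obtain k where k: "greedy_word n \<tau> k \<noteq> None" "greedy_word n \<tau> (Suc k) = None"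
    using ex_least_nat_less[of "\<lambda>k. greedy_word n \<tau> k = None" ?K]
    by (metis greedy_word.simps(1) option.distinct(1) order_refl)
  then obtain W where W: "greedy_word n \<tau> k = Some W" "greedy_step n W = None" by auto
  have "V = W" if V: "greedy_word n \<tau> l = Some V" "greedy_step n V = None" for V l
  proof -
    have "greedy_word n \<tau> (Suc l) = None" using V by simp
    with k W V have "k = l"
      by (metis greedy_word_mono not_less_eq_eq option.distinct(1) le_antisym)
    then show ?thesis using V W by simp
  qed
  with W show ?thesis unfolding greedy_output_def by blast
qed

end

theory Submission
  imports Defs
begin

text \<open>
  Consider the graph whose vertices are the patterns of length \<open>n - 1\<close> and whose edges are
  the patterns of length \<open>n\<close>, each leading from its prefix to its suffix. The algorithm walks
  along distinct edges, and at the increasing vertex it takes the loop \<open>1 2 \<dots> n\<close> only after the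
  other \<open>n - 1\<close> outgoing edges. If it ever did so, then, since the walk does not start at this
  vertex, it would have entered the vertex \<open>n\<close> times before; but apart from the loop only
  \<open>n - 1\<close> edges lead there. So the loop is never used, and \<open>C\<close> has fewer than \<open>n!\<close> letters.
\<close>

section \<open>Factors indexed by their starting position\<close>

definition window :: "nat \<Rightarrow> 'a list \<Rightarrow> nat \<Rightarrow> 'a list" where
  "window n w j = take n (drop j w)"

lemma length_window: "j + n \<le> length w \<Longrightarrow> length (window n w j) = n"
  by (simp add: window_def)

lemma distinct_window: "distinct w \<Longrightarrow> distinct (window n w j)"
  by (simp add: window_def)

lemma map_window: "window n (map f w) j = map f (window n w j)"
  by (simp add: window_def take_map drop_map)

lemma window_append: "j + n \<le> length w \<Longrightarrow> window n (w @ u) j = window n w j"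
  by (simp add: window_def)

text \<open>Together with \<open>tl_window\<close> this is the graph structure: the edge at position
  \<open>j\<close> leads from the vertex at \<open>j\<close> to the vertex at
  \<open>Suc j\<close>.\<close>

lemma butlast_window: "j + Suc m \<le> length w \<Longrightarrow> butlast (window (Suc m) w j) = window m w j"
  by (simp add: window_def butlast_take)

lemma tl_window: "tl (window (Suc m) w j) = window m w (Suc j)"
  by (simp add: window_def tl_take tl_drop drop_Suc)

lemma factors_eq_windows: "factors n w = window n w ` {j. j + n \<le> length w}"
proof -
  have "u \<in> window n w ` {j. j + n \<le> length w}" if u: "sublist u w" "length u = n" for u
  proof -
    obtain p s where w: "w = p @ u @ s" using u by (auto simp: sublist_def)
    then have "u = window n w (length p)" using u by (simp add: window_def)
    moreover have "length p + n \<le> length w" using w u by simp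
    ultimately show ?thesis by blast
  qed
  moreover have "sublist (window n w j) w" for j
    unfolding window_def using sublist_order.order_trans[OF sublist_take sublist_drop] .
  ultimately show ?thesis by (auto simp: factors_def length_window)
qed

section \<open>Reduced forms as order patterns\<close>

lemma red_nth_less_iff:
  assumes "i < length u" "j < length u"
  shows "red u ! i < red u ! j \<longleftrightarrow> u ! i < u ! j"
proof -
  \<comment> \<open>The letter \<open>b\<close> is counted for itself but not for the smaller
    \<open>a\<close>, so ranks increase strictly even if letters repeat.\<close>
  have less: "card {y \<in> set u. y \<le> a} < card {y \<in> set u. y \<le> b}" if "a < b" "b \<in> set u" for a b
  proof (rule psubset_card_mono)
    show "{y \<in> set u. y \<le> a} \<subset> {y \<in> set u. y \<le> b}"
      using that by (auto simp: psubset_eq set_eq_iff intro!: exI[of _ b])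
  qed simp
  have "card {y \<in> set u. y \<le> u ! j} \<le> card {y \<in> set u. y \<le> u ! i}" if "u ! j \<le> u ! i"
    using that by (intro card_mono) auto
  then show ?thesis
    using assms less[of "u ! i" "u ! j"] by (auto simp: red_def not_le[symmetric])
qed

lemma length_red [simp]: "length (red u) = length u"
  by (simp add: red_def)

text \<open>Distinct letters have distinct ranks, and \<open>length u\<close> ranks inside a set of
  that size must fill it.\<close>

lemma red_permutation:
  assumes "distinct u"
  shows "red u \<in> permutations_of_set {1..length u}"
proof -
  have d: "distinct (red u)"
    unfolding distinct_conv_nth
  proof (intro allI impI)
    fix i j assume "i < length (red u)" "j < length (red u)" "i \<noteq> j"
    then show "red u ! i \<noteq> red u ! j"
      using assms red_nth_less_iff[of i u j] red_nth_less_iff[of j u i]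
      by (metis length_red nth_eq_iff_index_eq linorder_neqE less_irrefl)
  qed
  have "card {y \<in> set u. y \<le> x} \<le> length u" for x
    using card_mono[of "set u" "{y \<in> set u. y \<le> x}"] card_length[of u] by auto
  moreover have "1 \<le> card {y \<in> set u. y \<le> x}" if "x \<in> set u" for x
    using that by (auto simp: Suc_le_eq card_gt_0_iff)
  ultimately have "set (red u) \<subseteq> {1..length u}" by (auto simp: red_def)
  then have "set (red u) = {1..length u}"
    using distinct_card[OF d] by (intro card_subset_eq) auto
  with d show ?thesis by (simp add: permutations_of_set_def)
qed

text \<open>Equal patterns agree on every comparison of two positions. This serves to show that an
  earlier use of an edge out of the increasing vertex was itself a visit to that vertex.\<close>

lemma sorted_wrt_butlast_of_red_eq:
  assumes "red u = red v" "sorted_wrt (<) (butlast v)"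
  shows "sorted_wrt (<) (butlast u)"
proof -
  have "length u = length v" using assms(1) by (metis length_red)
  moreover have "u ! i < u ! j \<longleftrightarrow> v ! i < v ! j" if "i < length u" "j < length u" for i j
    using that assms(1) calculation red_nth_less_iff[of i u j] red_nth_less_iff[of i v j] by simp
  ultimately show ?thesis
    using assms(2) by (auto simp: sorted_wrt_iff_nth_less nth_butlast)
qed

text \<open>Once the first rank is known, the remaining ranks have only one increasing arrangement.
  So an edge into the increasing vertex is identified by its first letter.\<close>

lemma red_eq_of_sorted_tl:
  fixes u :: "'a::linorder list"
  assumes "distinct u" "u \<noteq> []" "sorted_wrt (<) (tl u)"
  shows "red u = hd (red u) # sorted_list_of_set ({1..length u} - {hd (red u)})"
proof -
  have p: "distinct (red u)" "set (red u) = {1..length u}"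
    using red_permutation[OF assms(1)] by (auto simp: permutations_of_set_def)
  obtain r t where rt: "red u = r # t"
    using assms(2) by (metis length_red length_0_conv neq_Nil_conv)
  have "sorted_wrt (<) (tl (red u))"
    using assms(3) by (auto simp: sorted_wrt_iff_nth_less nth_tl red_nth_less_iff)
  then have "t = sorted_list_of_set (set t)"
    using rt by (simp add: strict_sorted_iff sorted_list_of_set.idem_if_sorted_distinct)
  moreover have "set t = {1..length u} - {r}" using p rt by auto
  ultimately show ?thesis using rt by simp
qed

lemma sorted_permutation_eq_upt:
  assumes "xs \<in> permutations_of_set {1..m}" "sorted xs"
  shows "xs = [1..<Suc m]"
proof -
  have xs: "set xs = {1..m}" "distinct xs"
    using assms(1) by (simp_all add: permutations_of_set_def)
  have "set xs = set [1..<Suc m]"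
    unfolding xs(1) set_upt by (simp only: atLeastLessThanSuc_atLeastAtMost)
  then show ?thesis
    by (rule sorted_distinct_set_unique[OF assms(2) xs(2) sorted_upt distinct_upt])
qed

text \<open>Among the edges into the increasing vertex, first letter 1 marks the loop; the others
  are left with first letters from 2 on.\<close>

lemma red_eq_upt_of_hd:
  assumes "distinct u" "u \<noteq> []" "sorted_wrt (<) (tl u)" "hd (red u) = 1"
  shows "red u = [1..<Suc (length u)]"
proof -
  have "sorted (red u)"
    by (subst red_eq_of_sorted_tl[OF assms(1-3)]) (simp add: assms(4))
  then show ?thesis using sorted_permutation_eq_upt red_permutation[OF assms(1)] by blast
qed

section \<open>Leaving and entering the increasing vertex\<close>

lemma sorted_wrt_less_map_bump: "sorted_wrt (<) (map (bump b) w) \<longleftrightarrow> sorted_wrt (<) w"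
  using strict_mono_less[OF strict_mono_bump] by (simp add: sorted_wrt_map)

text \<open>The letter at position \<open>i - 1\<close> tells the two apart: in extension
  \<open>i\<close> it is the letter bumped just above the last one, while in extension
  \<open>i'\<close> it stays below the last one.\<close>

lemma red_extension_inj:
  assumes v: "sorted_wrt (<) v" and i: "1 \<le> i" "i < i'" "i' \<le> length v"
  shows "red (extension i v) \<noteq> red (extension i' v)"
proof
  assume eq: "red (extension i v) = red (extension i' v)"
  have sl: "sorted_list_of_set (set v) = v"
    using v by (simp add: strict_sorted_iff sorted_list_of_set.idem_if_sorted_distinct)
  have e: "extension m v = map (bump (v ! (m - 1))) v @ [v ! (m - 1)]" if "m \<le> length v" for m
    using that by (simp add: extension_def sl Let_def)
  have len: "length (extension m v) = Suc (length v)" for m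
    by (subst extension_eq) simp
  have lt: "v ! (i - 1) < v ! (i' - 1)"
    using i by (intro sorted_wrt_nth_less[OF v]) auto
  have "\<not> extension i v ! (i - 1) < extension i v ! length v"
    using i by (simp add: e nth_append bump_def)
  moreover have "extension i' v ! (i - 1) < extension i' v ! length v"
    using i lt by (simp add: e nth_append bump_def)
  ultimately show False
    using red_nth_less_iff[of "i - 1" "extension i v" "length v"]
      red_nth_less_iff[of "i - 1" "extension i' v" "length v"] eq len i
    by (metis One_nat_def diff_le_self le_imp_less_Suc less_imp_le_nat lessI order_trans)
qed

lemma window_count_contradiction:
  fixes w :: "nat list"
  assumes d: "distinct w" and n: "2 \<le> n" and len: "n - 1 \<le> length w"
    and first: "\<not> sorted_wrt (<) (window (n - 1) w 0)"
    and inj: "inj_on (\<lambda>j. red (window n w j)) {j. j + n \<le> length w}"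
    and no_id: "[1..<Suc n] \<notin> red ` factors n w"
    and v: "v = window (n - 1) w (length w - (n - 1))" "sorted_wrt (<) v"
    and used: "\<And>i. i \<in> {1..n - 1} \<Longrightarrow> red (extension i v) \<in> red ` factors n w"
  shows False
proof -
  define k where "k = length w - (n - 1)"
  have lw: "length w = k + (n - 1)" using len k_def by simp
  have lv: "length v = n - 1" using v(1) len by (simp add: length_window)
  \<comment> \<open>The visits to the increasing vertex, including the final one at
    \<open>k\<close>, where no window of length \<open>n\<close> starts yet.\<close>
  define S where "S = {j. j \<le> k \<and> sorted_wrt (<) (window (n - 1) w j)}"
  have "\<exists>j. j < k \<and> red (window n w j) = red (extension i v)" if i: "i \<in> {1..n - 1}" for i
  proof -
    obtain j where "j + n \<le> length w" "red (extension i v) = red (window n w j)"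
      using used[OF i] by (auto simp: factors_eq_windows)
    then show ?thesis using n lw by (intro exI[of _ j]) simp
  qed
  \<comment> \<open>\<open>f i\<close> is the earlier position at which the \<open>i\<close>-th edge
    out of the increasing vertex was taken.\<close>
  then obtain f where f: "\<And>i. i \<in> {1..n - 1} \<Longrightarrow> f i < k"
    "\<And>i. i \<in> {1..n - 1} \<Longrightarrow> red (window n w (f i)) = red (extension i v)"
    by metis
  have "f i \<in> S" if i: "i \<in> {1..n - 1}" for i
  proof -
    have "sorted_wrt (<) (butlast (extension i v))"
      using v(2) by (subst extension_eq) (simp add: sorted_wrt_less_map_bump)
    then have "sorted_wrt (<) (butlast (window n w (f i)))"
      using sorted_wrt_butlast_of_red_eq f(2)[OF i] by blast
    then show ?thesis
      using f(1)[OF i] butlast_window[of "f i" "n - 1" w] n lw by (simp add: S_def)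
  qed
  moreover have "k \<in> S" using v by (simp add: S_def k_def)
  ultimately have sub: "insert k (f ` {1..n - 1}) \<subseteq> S" by auto
  have "inj_on f {1..n - 1}"
  proof (rule linorder_inj_onI)
    fix i i' assume "i < i'" "i \<in> {1..n - 1}" "i' \<in> {1..n - 1}"
    then show "f i \<noteq> f i'"
      using red_extension_inj[OF v(2), of i i'] f(2)[of i] f(2)[of i'] lv by auto
  qed auto
  moreover have "k \<notin> f ` {1..n - 1}" using f(1) by fastforce
  ultimately have "card (insert k (f ` {1..n - 1})) = n" using n by (simp add: card_image)
  moreover have finS: "finite S" by (simp add: S_def)
  ultimately have big: "n \<le> card S" using card_mono[OF finS sub] by simp

  \<comment> \<open>The label of the edge by which visit \<open>j\<close> was entered. Since
    \<open>0 - 1 = 0\<close> in \<nat>, position 0 has to be excluded; this is the role of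
    \<open>first\<close>.\<close>
  define g where "g j = hd (red (window n w (j - 1)))" for j
  have S0: "1 \<le> j" if "j \<in> S" for j
    using that first by (cases j) (auto simp: S_def)
  have W: "distinct (window n w (j - 1))" "window n w (j - 1) \<noteq> []"
    "length (window n w (j - 1)) = n" "j - 1 + n \<le> length w"
    "sorted_wrt (<) (tl (window n w (j - 1)))" if j: "j \<in> S" for j
  proof -
    show jn: "j - 1 + n \<le> length w" using S0[OF j] j n lw by (auto simp: S_def)
    show "distinct (window n w (j - 1))" using d by (rule distinct_window)
    show l: "length (window n w (j - 1)) = n" using jn by (rule length_window)
    show "window n w (j - 1) \<noteq> []" using l n by auto
    show "sorted_wrt (<) (tl (window n w (j - 1)))"
      using S0[OF j] j n tl_window[of "n - 1" w "j - 1"] by (simp add: S_def)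
  qed
  have "g j \<in> {2..n}" if j: "j \<in> S" for j
  proof -
    have "g j \<in> set (red (window n w (j - 1)))"
      unfolding g_def using W(2)[OF j] by (intro list.set_sel(1)) (simp add: red_def)
    then have "g j \<in> {1..n}"
      using red_permutation[OF W(1)[OF j]] W(3)[OF j] by (simp add: permutations_of_set_def)
    moreover have "g j \<noteq> 1"
    proof
      assume "g j = 1"
      then have "red (window n w (j - 1)) = [1..<Suc n]"
        using red_eq_upt_of_hd[OF W(1,2,5)[OF j]] W(3)[OF j] by (simp add: g_def)
      then show False using no_id W(4)[OF j] by (force simp: factors_eq_windows)
    qed
    ultimately show ?thesis by auto
  qed
  \<comment> \<open>Equal labels give equal patterns, and no pattern occurs at two
    positions.\<close>
  moreover have "inj_on g S"
  proof (rule inj_onI)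
    fix i j assume ij: "i \<in> S" "j \<in> S" and "g i = g j"
    moreover have "red (window n w (l - 1)) = g l # sorted_list_of_set ({1..n} - {g l})"
      if "l \<in> S" for l
      using red_eq_of_sorted_tl[OF W(1,2,5)[OF that]] unfolding W(3)[OF that] g_def .
    ultimately have "red (window n w (i - 1)) = red (window n w (j - 1))" by simp
    then have "i - 1 = j - 1" using inj W(4)[OF ij(1)] W(4)[OF ij(2)] by (auto dest: inj_onD)
    then show "i = j" using S0[OF ij(1)] S0[OF ij(2)] by simp
  qed
  ultimately have "card S \<le> card {2..n}" by (intro card_inj_on_le) auto
  with big n show False by simp
qed

section \<open>The invariant of the greedy algorithm\<close>

definition greedy_invariant :: "nat \<Rightarrow> nat list \<Rightarrow> bool" where
  "greedy_invariant n w \<longleftrightarrow>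
     distinct w \<and> n - 1 \<le> length w \<and> \<not> sorted_wrt (<) (window (n - 1) w 0) \<and>
     inj_on (\<lambda>j. red (window n w j)) {j. j + n \<le> length w} \<and>
     [1..<Suc n] \<notin> red ` factors n w"

text \<open>Relabelling by \<open>bump b\<close> keeps all old patterns, and the only new window is
  the extension, at position \<open>k\<close>. Its freshness preserves injectivity; if it were the
  loop, minimality of \<open>i\<close> would yield the premise \<open>used\<close> of
  \<open>window_count_contradiction\<close>.\<close>

lemma greedy_invariant_step:
  assumes n: "2 \<le> n" and inv: "greedy_invariant n w" and step: "greedy_step n w = Some w'"
  shows "greedy_invariant n w'"
proof -
  define k where "k = length w - (n - 1)"
  define v where "v = last_letters (n - 1) w"
  define i where "i = (LEAST i. admissible n w i)"
  define b where "b = last (extension i v)"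
  have ex: "\<exists>i. admissible n w i" and w': "w' = map (bump b) w @ [b]"
    using step by (auto simp: greedy_step_def Let_def v_def i_def b_def split: if_splits)
  have adm: "admissible n w i" unfolding i_def using ex by (metis LeastI)
  have d: "distinct w" and len: "n - 1 \<le> length w"
    and first: "\<not> sorted_wrt (<) (window (n - 1) w 0)"
    and inj: "inj_on (\<lambda>j. red (window n w j)) {j. j + n \<le> length w}"
    and no_id: "[1..<Suc n] \<notin> red ` factors n w"
    using inv by (auto simp: greedy_invariant_def)
  have lw: "length w = k + (n - 1)" using len k_def by simp
  have v: "v = window (n - 1) w (length w - (n - 1))"
    using len by (simp add: v_def last_letters_def window_def)
  have e: "extension i v = map (bump b) v @ [b]" unfolding b_def by (rule extension_eq)
  have new: "window n w' k = extension i v"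
  proof -
    have "window n w' k = take n (map (bump b) (drop k w) @ [b])"
      using lw by (simp add: window_def w' drop_map)
    also have "\<dots> = map (bump b) (drop k w) @ [b]" using lw n by simp
    also have "drop k w = v" by (simp add: v_def last_letters_def k_def)
    finally show ?thesis by (simp add: e)
  qed
  have old: "red (window n w' j) = red (window n w j)" if "j + n \<le> length w" for j
    using that by (simp add: w' window_append map_window red_map_bump)
  have idx: "{j. j + n \<le> length w'} = insert k {j. j + n \<le> length w}"
    using lw n by (auto simp: w')
  have fresh: "red (extension i v) \<notin> red ` factors n w"
    using adm by (simp add: admissible_def v_def)
  \<comment> \<open>\<open>bump b\<close> skips exactly the value \<open>b\<close>, which makes room
    for the new letter.\<close>
  have "b \<notin> bump b ` set w" by (auto simp: bump_def)
  then have "distinct w'"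
    using d strict_mono_imp_inj_on[OF strict_mono_bump, of b]
    by (auto simp: w' distinct_map intro: inj_on_subset)
  moreover have "\<not> sorted_wrt (<) (window (n - 1) w' 0)"
    using first len by (simp add: w' window_append map_window sorted_wrt_less_map_bump)
  moreover have "inj_on (\<lambda>j. red (window n w' j)) {j. j + n \<le> length w'}"
  proof -
    have "inj_on (\<lambda>j. red (window n w' j)) {j. j + n \<le> length w}"
      using inj old by (simp add: inj_on_def)
    moreover have "red (window n w' k) \<noteq> red (window n w' j)" if "j + n \<le> length w" for j
      using fresh that old[OF that] by (auto simp: new factors_eq_windows)
    ultimately show ?thesis unfolding idx by auto
  qed
  moreover have "[1..<Suc n] \<notin> red ` factors n w'"
  proof
    assume "[1..<Suc n] \<in> red ` factors n w'"
    then have "red (extension i v) = [1..<Suc n]"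
      using no_id old by (auto simp: factors_eq_windows idx new image_iff)
    then have id: "sorted_wrt (<) (red (extension i v))" by (metis sorted_wrt_upt)
    then have "sorted_wrt (<) (extension i v)"
      by (simp add: sorted_wrt_iff_nth_less red_nth_less_iff)
    then have sv: "sorted_wrt (<) v" and last: "\<And>x. x \<in> set v \<Longrightarrow> bump b x < b"
      by (auto simp: e sorted_wrt_append sorted_wrt_less_map_bump)
    have lv: "length v = n - 1" using v len by (simp add: length_window)
    \<comment> \<open>An index up to \<open>n - 1\<close> would pick \<open>b\<close> from
      \<open>v\<close>; that letter would be raised to \<open>b + 1\<close>, above the last letter,
      contradicting the increasing order.\<close>
    have "i > n - 1"
    proof (rule ccontr)
      assume "\<not> i > n - 1"
      then have "i \<le> length v" "i - 1 < length v"
        using lv adm n by (auto simp: admissible_def)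
      then have "b = sorted_list_of_set (set v) ! (i - 1)"
        by (simp add: b_def extension_def Let_def)
      moreover have "length (sorted_list_of_set (set v)) = length v"
        using sv by (simp add: strict_sorted_iff distinct_card)
      ultimately have "b \<in> set v"
        using \<open>i - 1 < length v\<close> by (metis List.finite_set nth_mem set_sorted_list_of_set)
      then show False using last[of b] by (simp add: bump_def)
    qed
    \<comment> \<open>All these indices lie below the least admissible one.\<close>
    then have "\<not> admissible n w m" if "m \<in> {1..n - 1}" for m
      using that not_less_Least[of m "admissible n w"] by (simp add: i_def)
    then have "red (extension m v) \<in> red ` factors n w" if "m \<in> {1..n - 1}" for m
      using that by (auto simp: admissible_def v_def)
    then show False
      using window_count_contradiction[OF d n len first inj no_id v sv] by blast
  qed
  ultimately show ?thesis using len by (simp add: greedy_invariant_def w')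
qed

lemma greedy_invariant_word:
  assumes "2 \<le> n" "greedy_invariant n \<tau>" "greedy_word n \<tau> k = Some w"
  shows "greedy_invariant n w"
  using assms(3)
proof (induction k arbitrary: w)
  case 0
  then show ?case using assms(2) by simp
next
  case (Suc k)
  then show ?case using greedy_invariant_step[OF assms(1)] by (auto simp: bind_eq_Some_conv)
qed

section \<open>Comparing the number of letters with \<open>fact n\<close>\<close>

lemma greedy_invariant_length:
  assumes "greedy_invariant n w"
  shows "length w - (n - 1) < fact n"
proof -
  let ?J = "{j. j + n \<le> length w}"
  let ?P = "permutations_of_set {1..n}"
  \<comment> \<open>The identity is missing among the patterns, so at most \<open>fact n - 1\<close>
    positions are available.\<close>
  have "red (window n w j) \<in> ?P - {[1..<Suc n]}" if "j \<in> ?J" for j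
  proof -
    have "window n w j \<in> factors n w" using that by (simp add: factors_eq_windows)
    then have "red (window n w j) \<noteq> [1..<Suc n]"
      using assms unfolding greedy_invariant_def by (metis imageI)
    then show ?thesis
      using assms that red_permutation[of "window n w j"]
      by (simp add: greedy_invariant_def distinct_window length_window)
  qed
  then have "card ?J \<le> card (?P - {[1..<Suc n]})"
    using assms by (intro card_inj_on_le[of "\<lambda>j. red (window n w j)"])
      (auto simp: greedy_invariant_def)
  moreover have "[1..<Suc n] \<in> ?P" by (auto simp: permutations_of_set_def)
  then have "card (?P - {[1..<Suc n]}) < fact n"
    by (simp add: card_Diff_singleton card_permutations_of_set)
  moreover have "finite ?J" by (rule finite_subset[of _ "{..length w}"]) auto
  \<comment> \<open>For \<open>n\<close> at least 1 these are exactly the starting positions of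
    windows, one for each letter that survives in \<open>C\<close>.\<close>
  then have "card {..<length w - (n - 1)} \<le> card ?J" by (rule card_mono) auto
  ultimately show ?thesis by simp
qed

text \<open>Every permutation needs a starting position of its own, as one position carries one
  pattern.\<close>

lemma universal_cycle_length:
  assumes "universal_cycle n c"
  shows "fact n \<le> length c"
proof -
  have "permutations_of_set {1..n} \<subseteq> (\<lambda>j. red (cyclic_factor c n j)) ` {..<length c}"
    using assms by (force simp: universal_cycle_def)
  then have "card (permutations_of_set {1..n}) \<le> length c"
    using surj_card_le[OF finite_lessThan] by (metis card_lessThan)
  then show ?thesis by simp
qed

theorem theorem2p5:
  fixes n :: nat and \<tau> W C :: "nat list"
  assumes "n \<ge> 2"
    and "\<tau> \<in> permutations_of_set {1..n - 1}"
    and "\<tau> \<noteq> [1..<n]"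
    and "greedy_output n \<tau> W"
    and "C = red (take (length W - (n - 1)) W)"
  shows "\<not> universal_cycle n C"
proof
  assume uc: "universal_cycle n C"
  have \<tau>: "distinct \<tau>" "length \<tau> = n - 1"
    using assms(2) by (auto simp: permutations_of_set_def dest: distinct_card)
  have "\<not> sorted_wrt (<) \<tau>"
    using sorted_permutation_eq_upt[OF assms(2)] assms(1,3) by (auto simp: strict_sorted_iff)
  \<comment> \<open>As \<open>\<tau>\<close> has only \<open>n - 1\<close> letters, it contains no
    window of length \<open>n\<close>, and its window of length \<open>n - 1\<close> at 0 is
    \<open>\<tau>\<close> itself.\<close>
  then have "greedy_invariant n \<tau>"
    using \<tau> assms(1)
    by (auto simp: greedy_invariant_def factors_eq_windows window_def inj_on_def)
  then have "greedy_invariant n W"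
    using greedy_invariant_word assms(1,4) by (auto simp: greedy_output_def)
  then have "length C < fact n"
    using greedy_invariant_length assms(5) by simp
  with universal_cycle_length[OF uc] show False by simp
qed

end
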